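(* Let $\mu$ be any $T$-invariant Borel probability measure on $2^{\mathbb{N}}$. Then there is an absolute constant $C>0$ such that for each positive integer $j$ and each $\varepsilon > 0$ there exist a natural number $n \leq 2^{C j/\varepsilon}$ and a set $A \subseteq n=\{0,\ldots,n-1\}$ such that for every finite binary string $\sigma$ of length at most $j$, \[ |\mu([\sigma]) - D_A(\sigma)| < \varepsilon. \] Moreover, for every $j$ and $\varepsilon>0$ there is an $m = m(j,\varepsilon)$ such that for every $n \geq m$ there is an $A \subseteq n$ with this same property.
   Context: Each natural number $n$ is identified with the set $\{0,\ldots,n-1\}$, and a subset $A \subseteq n$ is identified with the binary string of length $n$ whose $i$th digit is $1$ iff $i \in A$. For a finite binary string $\sigma$, say $\sigma$ occurs at position $i$ of $A$ (where $i<n$) if for every $j'$ less than the length of $\sigma$, the $j'$th bit of $\sigma$ equals the bit of $A$ at position $(i+j') \bmod n$ (i.e. with wraparound). Let $N_A(\sigma)$ be the number of positions $i<n$ at which $\sigma$ occurs in $A$, and $D_A(\sigma) = N_A(\sigma)/n$. $2^{\mathbb{N}}$ is Cantor space (infinite binary sequences with the product topology); for a finite binary string $\sigma$, $[\sigma]$ is the set of infinite sequences having $\sigma$ as an initial segment. $T$ is the left shift, $(T\omega)(k) = \omega(k+1)$, and $\mu$ is $T$-invariant if $\mu(T^{-1}B) = \mu(B)$ for every Borel $B$. *)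

theory Defs
  imports "HOL-Probability.Probability"
begin

text \<open>Cantor space is the type \<^typ>\<open>nat \<Rightarrow> bool\<close>, with \<^const>\<open>borel\<close> taken for the library's product
  topology on functions over the discrete type \<^typ>\<open>bool\<close>. The digit 1 is \<^const>\<open>True\<close>.\<close>

definition shift :: "(nat \<Rightarrow> bool) \<Rightarrow> (nat \<Rightarrow> bool)" where
  "shift \<omega> = (\<lambda>k. \<omega> (k + 1))"

definition cylinder :: "bool list \<Rightarrow> (nat \<Rightarrow> bool) set" where
  "cylinder \<sigma> = {\<omega>. \<forall>k<length \<sigma>. \<omega> k = \<sigma> ! k}"

definition borel_prob :: "(nat \<Rightarrow> bool) measure \<Rightarrow> bool" where
  "borel_prob \<mu> \<longleftrightarrow> prob_space \<mu> \<and> sets \<mu> = sets borel"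

definition shift_invariant :: "(nat \<Rightarrow> bool) measure \<Rightarrow> bool" where
  "shift_invariant \<mu> \<longleftrightarrow> (\<forall>B\<in>sets borel. measure \<mu> (shift -` B) = measure \<mu> B)"

text \<open>A set \<open>A \<subseteq> {..<n}\<close> is read as the cyclic binary string of length \<open>n\<close> with digit \<open>i \<in> A\<close> at
  position \<open>i\<close>.\<close>

definition occurs_at :: "nat \<Rightarrow> nat set \<Rightarrow> bool list \<Rightarrow> nat \<Rightarrow> bool" where
  "occurs_at n A \<sigma> i \<longleftrightarrow> (\<forall>j'<length \<sigma>. \<sigma> ! j' = ((i + j') mod n \<in> A))"

definition occ_count :: "nat \<Rightarrow> nat set \<Rightarrow> bool list \<Rightarrow> nat" where
  "occ_count n A \<sigma> = card {i. i < n \<and> occurs_at n A \<sigma> i}"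

text \<open>Only meaningful for \<open>n > 0\<close>; for \<open>n = 0\<close> the value is 0 by the convention on division.\<close>

definition occ_density :: "nat \<Rightarrow> nat set \<Rightarrow> bool list \<Rightarrow> real" where
  "occ_density n A \<sigma> = real (occ_count n A \<sigma>) / real n"

definition approximates :: "(nat \<Rightarrow> bool) measure \<Rightarrow> nat \<Rightarrow> real \<Rightarrow> nat \<Rightarrow> nat set \<Rightarrow> bool" where
  "approximates \<mu> j \<epsilon> n A \<longleftrightarrow>
     (\<forall>\<sigma>. length \<sigma> \<le> j \<longrightarrow> \<bar>measure \<mu> (cylinder \<sigma>) - occ_density n A \<sigma>\<bar> < \<epsilon>)"

end

theory Submission
  imports Defs
begin

text \<open>Concatenate words of length \<open>L\<close>, each word \<open>w\<close> being used about \<open>M * \<mu>([w])\<close> times out of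
  \<open>M\<close>. By invariance, the expected number of occurrences of \<open>\<sigma>\<close> at a fixed offset inside a
  \<open>\<mu>\<close>-random word is \<open>\<mu>([\<sigma>])\<close>; so the error comes only from occurrences that straddle two words
  (relative size \<open>j / L\<close>) and from rounding (at most \<open>2 ^ L\<close> words). It suffices that \<open>L\<close> is about
  \<open>4 j / \<epsilon>\<close> and that the total length is at least \<open>4 L 2 ^ L / \<epsilon>\<close>.\<close>

section \<open>Lists with prescribed frequencies\<close>

lemma sum_list_concat_replicate:
  fixes h :: "'a \<Rightarrow> real"
  assumes "distinct ws"
  shows "sum_list (map h (concat (map (\<lambda>w. replicate (m w) w) ws))) = (\<Sum>w\<in>set ws. real (m w) * h w)"
  using assms by (induction ws) (auto simp: sum_list_replicate)

lemma length_concat_replicate: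
  assumes "distinct ws"
  shows "length (concat (map (\<lambda>w. replicate (m w) w) ws)) = sum m (set ws)"
  using assms by (induction ws) auto

text \<open>Round each \<open>M * p w\<close> down and pad the list to length \<open>M\<close>.
  Rounding down loses less than one copy per word, so at most \<open>card W\<close> padding entries
  are required. The loss and the padding have opposite signs, so the error is
  \<open>card W * B\<close> and not twice that. The list is fixed before \<open>h\<close>, which
  later lets one set \<open>A\<close> serve all \<open>\<sigma>\<close> at once.\<close>

lemma exists_list_with_frequencies:
  fixes p :: "'a \<Rightarrow> real"
  assumes fin: "finite W" and p0: "\<And>w. w \<in> W \<Longrightarrow> p w \<ge> 0" and p1: "sum p W = 1"
  obtains xs where "length xs = M"
    and "\<And>h B. (\<And>w. 0 \<le> h w \<and> h w \<le> B) \<Longrightarrow>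
           \<bar>sum_list (map h xs) - real M * (\<Sum>w\<in>W. p w * h w)\<bar> \<le> real (card W) * B"
proof -
  obtain ws where ws: "set ws = W" "distinct ws"
    using finite_distinct_list[OF fin] by blast
  define m where "m w = nat \<lfloor>real M * p w\<rfloor>" for w
  define rest where "rest = M - sum m W"
  \<comment> \<open>The padding entry may lie outside \<open>W\<close>; this is why \<open>h\<close>
    is bounded on the whole type and not only on \<open>W\<close>.\<close>
  define xs where "xs = concat (map (\<lambda>w. replicate (m w) w) ws) @ replicate rest undefined"
  have m: "real (m w) \<le> real M * p w \<and> real M * p w \<le> real (m w) + 1" if "w \<in> W" for w
    using p0[OF that] unfolding m_def by (simp; linarith)
  have Mp: "(\<Sum>w\<in>W. real M * p w) = real M"
    using p1 by (simp flip: sum_distrib_left)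
  have "(\<Sum>w\<in>W. real (m w)) \<le> (\<Sum>w\<in>W. real M * p w)"
    using m by (intro sum_mono) auto
  then have le: "sum m W \<le> M"
    using Mp by (simp flip: of_nat_sum)
  then have rest: "real rest = real M - (\<Sum>w\<in>W. real (m w))"
    by (simp add: rest_def of_nat_diff)
  have "(\<Sum>w\<in>W. real M * p w) \<le> (\<Sum>w\<in>W. real (m w) + 1)"
    using m by (intro sum_mono) auto
  then have rest_le: "real rest \<le> card W"
    using Mp rest by (simp add: sum.distrib)
  have "length xs = M"
    using le by (simp add: xs_def length_concat_replicate ws rest_def)
  moreover have "\<bar>sum_list (map h xs) - real M * (\<Sum>w\<in>W. p w * h w)\<bar> \<le> real (card W) * B"
    if h: "\<And>w. 0 \<le> h w \<and> h w \<le> B" for h B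
  proof -
    have eq: "sum_list (map h xs) = (\<Sum>w\<in>W. real (m w) * h w) + real rest * h undefined"
      using ws by (simp add: xs_def sum_list_concat_replicate sum_list_replicate)
    have eq': "real M * (\<Sum>w\<in>W. p w * h w) = (\<Sum>w\<in>W. real M * p w * h w)"
      by (simp add: sum_distrib_left mult.assoc)
    have up: "(\<Sum>w\<in>W. real (m w) * h w) \<le> (\<Sum>w\<in>W. real M * p w * h w)"
      using m h by (intro sum_mono mult_right_mono) auto
    have "(\<Sum>w\<in>W. real M * p w * h w) \<le> (\<Sum>w\<in>W. real (m w) * h w + B)"
    proof (rule sum_mono)
      fix w assume "w \<in> W"
      then have "real M * p w * h w \<le> (real (m w) + 1) * h w"
        using m h by (intro mult_right_mono) auto
      then show "real M * p w * h w \<le> real (m w) * h w + B"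
        using h[of w] by (simp add: distrib_right)
    qed
    then have low: "(\<Sum>w\<in>W. real M * p w * h w) \<le> (\<Sum>w\<in>W. real (m w) * h w) + card W * B"
      by (simp add: sum.distrib)
    have "0 \<le> real rest * h undefined" "real rest * h undefined \<le> card W * B"
      using h rest_le by (auto intro!: mult_mono)
    then show ?thesis
      using up low unfolding eq eq' by linarith
  qed
  ultimately show thesis
    using that by blast
qed

section \<open>Words, shifted cylinders and invariance\<close>

definition matches :: "bool list \<Rightarrow> bool list \<Rightarrow> nat \<Rightarrow> bool" where
  "matches \<sigma> w s \<longleftrightarrow> (\<forall>k<length \<sigma>. w ! (s + k) = \<sigma> ! k)"

text \<open>This is the preimage of \<open>cylinder \<sigma>\<close> under the \<open>s\<close>-th
  iterate of \<open>shift\<close>.\<close>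

definition cylinder_at :: "nat \<Rightarrow> bool list \<Rightarrow> (nat \<Rightarrow> bool) set" where
  "cylinder_at s \<sigma> = {\<omega>. \<forall>k<length \<sigma>. \<omega> (s + k) = \<sigma> ! k}"

lemma cylinder_at_0: "cylinder_at 0 \<sigma> = cylinder \<sigma>"
  by (simp add: cylinder_at_def cylinder_def)

lemma cylinder_at_borel: "cylinder_at s \<sigma> \<in> sets borel"
proof -
  have "open ((\<lambda>\<omega>::nat \<Rightarrow> bool. \<omega> i) -` {b})" for i b
    by (intro open_vimage Topological_Spaces.open_discrete continuous_on_product_coordinates)
  then have "open (\<Inter>k\<in>{..<length \<sigma>}. (\<lambda>\<omega>::nat \<Rightarrow> bool. \<omega> (s + k)) -` {\<sigma> ! k})"
    by (intro open_INT) auto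
  moreover have "(\<Inter>k\<in>{..<length \<sigma>}. (\<lambda>\<omega>::nat \<Rightarrow> bool. \<omega> (s + k)) -` {\<sigma> ! k}) = cylinder_at s \<sigma>"
    by (auto simp: cylinder_at_def)
  ultimately show ?thesis
    by simp
qed

text \<open>Pulling back along \<open>shift\<close> moves the window one place to the right, so
  invariance is applied \<open>s\<close> times. It enters the whole argument only here.\<close>

lemma measure_cylinder_at:
  assumes "shift_invariant \<mu>"
  shows "measure \<mu> (cylinder_at s \<sigma>) = measure \<mu> (cylinder \<sigma>)"
proof (induction s)
  case (Suc s)
  have "shift -` cylinder_at s \<sigma> = cylinder_at (Suc s) \<sigma>"
    by (auto simp: shift_def cylinder_at_def)
  then show ?case
    using assms Suc cylinder_at_borel unfolding shift_invariant_def by metis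
qed (simp add: cylinder_at_0)

lemma finite_words: "finite {w :: bool list. length w = L}"
  using finite_lists_length_eq[of "UNIV :: bool set" L] by simp

lemma card_words: "card {w :: bool list. length w = L} = 2 ^ L"
  using card_lists_length_eq[of "UNIV :: bool set" L] by simp

text \<open>The window ends by position \<open>L\<close>, so the first \<open>L\<close> digits of a
  sequence decide whether it lies in \<open>cylinder_at s \<sigma>\<close>. That set is therefore a
  finite disjoint union of cylinders of words of length \<open>L\<close>.\<close>

lemma sum_measure_words:
  assumes \<mu>: "borel_prob \<mu>" and len: "s + length \<sigma> \<le> L"
  shows "(\<Sum>w | length w = L \<and> matches \<sigma> w s. measure \<mu> (cylinder w)) = measure \<mu> (cylinder_at s \<sigma>)"
proof -
  interpret prob_space \<mu> using \<mu> by (simp add: borel_prob_def)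
  let ?W = "{w. length w = L \<and> matches \<sigma> w s}"
  have sub: "cylinder ` ?W \<subseteq> sets \<mu>"
    using \<mu> cylinder_at_borel[of 0] by (auto simp: borel_prob_def cylinder_at_0)
  have disj: "disjoint_family_on cylinder ?W"
    by (auto simp: disjoint_family_on_def cylinder_def intro!: nth_equalityI)
  have "\<omega> \<in> (\<Union>w\<in>?W. cylinder w)" if "\<omega> \<in> cylinder_at s \<sigma>" for \<omega>
    using that len
    by (intro UN_I[of "map \<omega> [0..<L]"]) (auto simp: cylinder_def cylinder_at_def matches_def)
  moreover have "\<omega> \<in> cylinder_at s \<sigma>" if "\<omega> \<in> (\<Union>w\<in>?W. cylinder w)" for \<omega>
    using that len by (auto simp: cylinder_def cylinder_at_def matches_def)
  ultimately have "(\<Union>w\<in>?W. cylinder w) = cylinder_at s \<sigma>"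
    by blast
  then show ?thesis
    using finite_measure_finite_Union[OF _ sub disj] finite_words by simp
qed

section \<open>Occurrences in a concatenation of words\<close>

text \<open>A start \<open>t * L + s\<close> with \<open>s < L - j\<close> keeps its window inside
  block \<open>t\<close>, so the occurrences at such starts are exactly the \<open>N\<close> matches
  within words. The remaining \<open>n - M * (L - j)\<close> starts may contribute anything from
  none to all. The upper bound is written additively to avoid truncated subtraction.\<close>

lemma occ_count_concatenation:
  fixes xs :: "bool list list" and L n :: nat
  defines "M \<equiv> length xs"
  defines "A \<equiv> {i. i < n \<and> i div L < M \<and> xs ! (i div L) ! (i mod L)}"
  assumes n: "M * L \<le> n" and j: "length \<sigma> \<le> j" "j \<le> L"
  defines "N \<equiv> (\<Sum>t<M. card {s. s < L - j \<and> matches \<sigma> (xs ! t) s})"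
  shows "N \<le> occ_count n A \<sigma>" and "occ_count n A \<sigma> + M * (L - j) \<le> N + n"
proof -
  define I where "I = (\<lambda>(t, s). t * L + s) ` ({..<M} \<times> {..<L - j})"
  have inj: "inj_on (\<lambda>(t, s). t * L + s) ({..<M} \<times> {..<L - j})"
  proof (rule inj_onI, clarsimp)
    fix t s t' s'
    assume eq: "t * L + s = t' * L + s'" and "s < L - j" "s' < L - j"
    from this(2-) have "(t * L + s) div L = t" "(t' * L + s') div L = t'"
      by auto
    then have "t = t'"
      using eq by metis
    with eq show "t = t' \<and> s = s'"
      by simp
  qed
  \<comment> \<open>From \<open>s < L - j\<close> and \<open>k \<le> j\<close> follows
    \<open>s + k < L\<close>, so the position precedes
    \<open>(t + 1) * L \<le> M * L \<le> n\<close>.\<close>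
  have lt: "t * L + s + k < n" if "t < M" "s < L - j" "k \<le> j" for t s k
  proof -
    have "(t + 1) * L \<le> M * L"
      using that by (intro mult_right_mono) auto
    then show ?thesis
      using that n by simp
  qed
  have "I \<subseteq> {..<n}"
    using lt[where k = 0] by (auto simp: I_def)
  have card_I: "card I = M * (L - j)"
    unfolding I_def by (simp add: card_image[OF inj])
  have occurs: "occurs_at n A \<sigma> (t * L + s) \<longleftrightarrow> matches \<sigma> (xs ! t) s" if ts: "t < M" "s < L - j" for t s
  proof -
    \<comment> \<open>There is no wraparound here. Both sides read the digit by the same
      \<open>!\<close>, so the equivalence also covers a padding word of unknown length.\<close>
    have "(t * L + s + k) mod n \<in> A \<longleftrightarrow> xs ! t ! (s + k)" if k: "k < length \<sigma>" for k
    proof -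
      have less: "s + k < L" "t * L + s + k < n"
        using lt[OF ts, of k] ts k j by auto
      have "(t * L + s + k) div L = t"
        using less(1) by (simp add: add.assoc)
      moreover have "(t * L + s + k) mod L = s + k"
        using less(1) by (simp add: add.assoc)
      ultimately show ?thesis
        using less ts by (simp add: A_def)
    qed
    then show ?thesis
      by (auto simp: occurs_at_def matches_def)
  qed
  define Z where "Z = {i. i < n \<and> occurs_at n A \<sigma> i}"
  have "Z \<inter> I = (\<lambda>(t, s). t * L + s) ` (SIGMA t:{..<M}. {s. s < L - j \<and> matches \<sigma> (xs ! t) s})"
    using occurs lt[where k = 0] by (fastforce simp: Z_def I_def)
  moreover have "inj_on (\<lambda>(t, s). t * L + s) (SIGMA t:{..<M}. {s. s < L - j \<and> matches \<sigma> (xs ! t) s})"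
    by (rule inj_on_subset[OF inj]) auto
  ultimately have card_ZI: "card (Z \<inter> I) = N"
    by (simp add: card_image N_def)
  have fin: "finite Z"
    by (simp add: Z_def)
  have occ: "occ_count n A \<sigma> = card Z"
    by (simp add: occ_count_def Z_def)
  show "N \<le> occ_count n A \<sigma>"
    using card_mono[OF fin, of "Z \<inter> I"] by (simp add: card_ZI occ)
  \<comment> \<open>Inclusion-exclusion: \<open>card Z + card I\<close> equals
    \<open>card (Z \<union> I) + card (Z \<inter> I)\<close>, which is at most
    \<open>n + N\<close>.\<close>
  have "card (Z \<union> I) \<le> n"
    using card_mono[of "{..<n}" "Z \<union> I"] \<open>I \<subseteq> {..<n}\<close> by (auto simp: Z_def)
  then show "occ_count n A \<sigma> + M * (L - j) \<le> N + n"
    using card_Un_Int[OF fin, of I] finite_subset[OF \<open>I \<subseteq> {..<n}\<close>]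
    by (simp add: card_ZI card_I occ)
qed

section \<open>The error estimate\<close>

text \<open>The errors, counted in positions, are at most \<open>n * \<epsilon> / 4\<close> each:
  \<open>M * j\<close> for starts near block ends (by the bound on \<open>L\<close>), and
  \<open>2 ^ L * L\<close> for rounding and \<open>L\<close> for the incomplete last block (both by
  the bound on \<open>n\<close>). The remaining quarter makes the inequality strict.\<close>

lemma approximates_if_long:
  assumes \<mu>: "borel_prob \<mu>" "shift_invariant \<mu>"
    and j: "j \<ge> 1" "j \<le> L" and \<epsilon>: "\<epsilon> > 0"
    and L: "4 * real j / \<epsilon> \<le> real L"
    and n: "4 * real L * 2 ^ L / \<epsilon> \<le> real n"
  shows "\<exists>A\<subseteq>{..<n}. approximates \<mu> j \<epsilon> n A"
proof -
  interpret prob_space \<mu> using \<mu> by (simp add: borel_prob_def)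
  define W where "W = {w :: bool list. length w = L}"
  define M where "M = n div L"
  \<comment> \<open>The empty word matches everywhere, so the cylinders of all words of length
    \<open>L\<close> have total mass 1.\<close>
  have "(\<Sum>w\<in>W. measure \<mu> (cylinder w)) = measure \<mu> (cylinder_at 0 [])"
    using sum_measure_words[OF \<mu>(1), of 0 "[]" L] by (simp add: matches_def W_def)
  also have "cylinder_at 0 [] = space \<mu>"
    using \<mu>(1) sets_eq_imp_space_eq[of \<mu> borel] by (simp add: borel_prob_def cylinder_at_def)
  finally have "(\<Sum>w\<in>W. measure \<mu> (cylinder w)) = 1"
    by (simp add: prob_space)
  then obtain xs where len: "length xs = M"
    and xs: "\<And>h B. (\<And>w. 0 \<le> h w \<and> h w \<le> B) \<Longrightarrow>
      \<bar>sum_list (map h xs) - real M * (\<Sum>w\<in>W. measure \<mu> (cylinder w) * h w)\<bar> \<le> real (card W) * B"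
    using exists_list_with_frequencies[of W "\<lambda>w. measure \<mu> (cylinder w)" M thesis]
    unfolding W_def using finite_words measure_nonneg by blast
  \<comment> \<open>The fewer than \<open>L\<close> positions after the last complete block carry
    the digit 0.\<close>
  define A where "A = {i. i < n \<and> i div L < M \<and> xs ! (i div L) ! (i mod L)}"
  have L0: "real L > 0" using j by simp
  have "0 < 4 * real L * 2 ^ L / \<epsilon>" using L0 \<epsilon> by simp
  then have n0: "real n > 0" using n by linarith
  have blocks_nat: "M * L \<le> n" "n \<le> M * L + L"
    using div_mult_mod_eq[of n L] mod_less_divisor[of L n] j unfolding M_def by linarith+
  then have blocks: "real M * real L \<le> real n" "real n \<le> real M * real L + real L"
    by (simp_all flip: of_nat_mult of_nat_add)
  have Mj: "real M * real j \<le> real n * \<epsilon> / 4"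
  proof -
    have "real M * real j \<le> real M * (real L * \<epsilon> / 4)"
      using L \<epsilon> by (intro mult_left_mono) (auto simp: field_simps)
    also have "\<dots> \<le> real n * \<epsilon> / 4"
      using blocks(1) \<epsilon> by (simp add: mult.assoc[symmetric])
    finally show ?thesis .
  qed
  have K: "2 ^ L * real L \<le> real n * \<epsilon> / 4"
    using n \<epsilon> by (simp add: field_simps)
  have L_le: "real L \<le> real n * \<epsilon> / 4"
  proof -
    have "1 * real L \<le> 2 ^ L * real L"
      by (intro mult_right_mono) auto
    then show ?thesis using K by linarith
  qed
  have "\<bar>measure \<mu> (cylinder \<sigma>) - occ_density n A \<sigma>\<bar> < \<epsilon>" if \<sigma>: "length \<sigma> \<le> j" for \<sigma>
  proof -
    define P where "P = measure \<mu> (cylinder \<sigma>)"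
    define h where "h w = real (card {s. s < L - j \<and> matches \<sigma> w s})" for w
    define N where "N = (\<Sum>t<M. card {s. s < L - j \<and> matches \<sigma> (xs ! t) s})"
    have N: "real N = sum_list (map h xs)"
      by (simp add: N_def h_def sum_list_sum_nth len atLeast0LessThan)
    have h_sum: "h w = (\<Sum>s<L - j. of_bool (matches \<sigma> w s))" for w
      by (simp add: h_def Collect_conj_eq lessThan_def of_bool_def sum.If_cases)
    have h_le: "0 \<le> h w \<and> h w \<le> real (L - j)" for w
      using card_mono[of "{..<L - j}" "{s. s < L - j \<and> matches \<sigma> w s}"] by (auto simp: h_def)
    \<comment> \<open>The expected number of matches in a random word is summed offset by offset;
      each of the \<open>L - j\<close> offsets contributes \<open>P\<close> by invariance.\<close>
    have "(\<Sum>w\<in>W. measure \<mu> (cylinder w) * h w)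
        = (\<Sum>s<L - j. \<Sum>w\<in>W. measure \<mu> (cylinder w) * of_bool (matches \<sigma> w s))"
      unfolding h_sum sum_distrib_left by (rule sum.swap)
    also have "\<dots> = (\<Sum>s<L - j. P)"
    proof (rule sum.cong[OF refl])
      fix s assume s: "s \<in> {..<L - j}"
      have "(\<Sum>w\<in>W. measure \<mu> (cylinder w) * of_bool (matches \<sigma> w s))
          = (\<Sum>w | length w = L \<and> matches \<sigma> w s. measure \<mu> (cylinder w))"
        using finite_words[of L]
        by (intro sum.mono_neutral_cong_right) (auto simp: W_def)
      also have "\<dots> = P"
        using sum_measure_words[OF \<mu>(1), of s \<sigma> L] measure_cylinder_at[OF \<mu>(2)] s \<sigma>
        by (simp add: P_def)
      finally show "(\<Sum>w\<in>W. measure \<mu> (cylinder w) * of_bool (matches \<sigma> w s)) = P" .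
    qed
    finally have "\<bar>real N - real M * (real (L - j) * P)\<bar> \<le> 2 ^ L * real (L - j)"
      using xs[of h, OF h_le] by (simp add: N W_def card_words)
    moreover have "2 ^ L * real (L - j) \<le> 2 ^ L * real L"
      by (intro mult_left_mono) auto
    ultimately have N_P: "\<bar>real N - real M * real (L - j) * P\<bar> \<le> real n * \<epsilon> / 4"
      using K unfolding mult.assoc[of "real M"] by linarith
    \<comment> \<open>\<open>R\<close> is the number of starts outside the controlled ones: the
      block ends and the tail.\<close>
    define R where "R = real n - real M * real (L - j)"
    have "R = (real n - real M * real L) + real M * real j"
      using j by (simp add: R_def of_nat_diff right_diff_distrib)
    moreover have "real M * real j \<ge> 0"
      by simp
    ultimately have R: "R \<ge> 0" "R \<le> real n * \<epsilon> / 2"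
      using blocks Mj L_le by linarith+
    have "0 \<le> P" "P \<le> 1"
      by (simp_all add: P_def)
    then have RP: "0 \<le> R * P" "R * P \<le> R"
      using R(1) by (simp_all add: mult_left_le)
    have "N \<le> occ_count n A \<sigma>" "occ_count n A \<sigma> + M * (L - j) \<le> N + n"
      using occ_count_concatenation[of xs L n \<sigma> j] blocks_nat(1) \<sigma> j(2) by (simp_all add: len A_def N_def)
    then have "real N \<le> occ_count n A \<sigma>" "real (occ_count n A \<sigma>) \<le> real N + R"
      by (simp_all add: R_def flip: of_nat_mult of_nat_add)
    \<comment> \<open>Split \<open>n * P\<close> as \<open>M * (L - j) * P + R * P\<close>. Both
      \<open>R * P\<close> and \<open>occ_count n A \<sigma> - N\<close> lie between 0 and
      \<open>R\<close>, so they differ by at most \<open>R\<close>, which is thus charged only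
      once.\<close>
    then have "\<bar>real n * P - occ_count n A \<sigma>\<bar> \<le> real n * \<epsilon> / 4 + R"
      using N_P RP by (simp add: R_def left_diff_distrib; linarith)
    also have "\<dots> < real n * \<epsilon>"
      using R(2) mult_pos_pos[OF n0 \<epsilon>] by linarith
    finally have "\<bar>real n * P - occ_count n A \<sigma>\<bar> / real n < \<epsilon>"
      using n0 by (simp add: field_simps)
    moreover have "\<bar>real n * P - occ_count n A \<sigma>\<bar> / real n = \<bar>P - occ_density n A \<sigma>\<bar>"
    proof -
      have "P - occ_density n A \<sigma> = (real n * P - occ_count n A \<sigma>) / real n"
        using n0 by (simp add: occ_density_def field_simps)
      then show ?thesis by simp
    qed
    ultimately show ?thesis
      by (simp add: P_def)
  qed
  then have "approximates \<mu> j \<epsilon> n A"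
    by (simp add: approximates_def)
  moreover have "A \<subseteq> {..<n}"
    by (auto simp: A_def)
  ultimately show ?thesis
    by blast
qed

section \<open>Large \<open>\<epsilon>\<close> and the bound on the length\<close>

lemma occ_density_le_1: "occ_density n A \<sigma> \<le> 1"
proof -
  have "occ_count n A \<sigma> \<le> n"
    unfolding occ_count_def using card_mono[of "{..<n}" "{i. i < n \<and> occurs_at n A \<sigma> i}"] by auto
  then show ?thesis
    by (auto simp: occ_density_def divide_le_eq_1)
qed

lemma approximates_trivial:
  assumes "borel_prob \<mu>" "\<epsilon> > 1"
  shows "approximates \<mu> j \<epsilon> n A"
  unfolding approximates_def
proof (intro allI impI)
  fix \<sigma>
  interpret prob_space \<mu> using assms by (simp add: borel_prob_def)
  have "0 \<le> occ_density n A \<sigma>" "occ_density n A \<sigma> \<le> 1"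
    "0 \<le> measure \<mu> (cylinder \<sigma>)" "measure \<mu> (cylinder \<sigma>) \<le> 1"
    using occ_density_le_1 by (simp_all add: occ_density_def)
  then show "\<bar>measure \<mu> (cylinder \<sigma>) - occ_density n A \<sigma>\<bar> < \<epsilon>"
    using assms(2) by linarith
qed

text \<open>With \<open>q = j / \<epsilon>\<close>, rounding up gives
  \<open>L \<le> 4 * q + 1\<close> and \<open>n \<le> 8 * L * 2 ^ L / \<epsilon>\<close>. Bounding
  \<open>L\<close> by \<open>2 ^ L\<close> and \<open>1 / \<epsilon>\<close> by
  \<open>2 powr (1 / \<epsilon>)\<close> yields the exponent
  \<open>3 + 2 * L + 1 / \<epsilon> \<le> 5 + 9 * q\<close>, and \<open>q \<ge> 1\<close> turns this
  into \<open>14 * q\<close>.\<close>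

lemma length_bound:
  fixes j :: nat and \<epsilon> :: real
  assumes "j \<ge> 1" "0 < \<epsilon>" "\<epsilon> \<le> 1"
  defines "L \<equiv> nat \<lceil>4 * real j / \<epsilon>\<rceil>"
  defines "n \<equiv> nat \<lceil>4 * real L * 2 ^ L / \<epsilon>\<rceil>"
  shows "j \<le> L" and "n \<ge> 1" and "real n \<le> 2 powr (14 * real j / \<epsilon>)"
proof -
  define q where "q = real j / \<epsilon>"
  have q: "real j \<le> q" "1 \<le> q" "1 / \<epsilon> \<le> q"
    using assms(1-3) mult_left_mono[of \<epsilon> 1 "real j"] by (auto simp: q_def field_simps)
  have L: "4 * q \<le> real L" "real L \<le> 4 * q + 1"
    using q unfolding L_def q_def by (simp_all; linarith)+
  show "j \<le> L"
    using q L by linarith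
  have L0: "real L \<ge> 1"
    using q L by linarith
  define x where "x = 4 * real L * 2 ^ L / \<epsilon>"
  have "1 * 1 \<le> (4 * real L) * (2 ^ L / \<epsilon>)"
    using L0 assms(2,3) by (intro mult_mono) (auto simp: field_simps intro: order_trans[OF _ one_le_power])
  then have x1: "x \<ge> 1"
    by (simp add: x_def)
  \<comment> \<open>Since \<open>x \<ge> 1\<close>, the ceiling is at most
    \<open>x + 1 \<le> 2 * x\<close>.\<close>
  then have n: "n \<ge> 1" "real n \<le> 2 * x"
    unfolding n_def x_def[symmetric] by linarith+
  show "n \<ge> 1" by fact
  have "real L \<le> 2 powr real L"
    using of_nat_less_two_power[of L, where 'a = real] by (simp add: powr_realpow)
  moreover have "1 / \<epsilon> \<le> 2 powr (1 / \<epsilon>)"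
  proof -
    \<comment> \<open>Passing to the floor \<open>k\<close> reduces the claim to
      \<open>k + 1 \<le> 2 ^ k\<close> for natural numbers.\<close>
    have "1 / \<epsilon> \<le> real (nat \<lfloor>1 / \<epsilon>\<rfloor>) + 1"
      using assms(2) by (simp; linarith)
    also have "\<dots> \<le> 2 ^ nat \<lfloor>1 / \<epsilon>\<rfloor>"
      using less_exp[of "nat \<lfloor>1 / \<epsilon>\<rfloor>"]
      by (metis Suc_leI of_nat_Suc of_nat_le_iff of_nat_numeral of_nat_power add.commute)
    also have "\<dots> = 2 powr real (nat \<lfloor>1 / \<epsilon>\<rfloor>)"
      by (simp add: powr_realpow)
    also have "\<dots> \<le> 2 powr (1 / \<epsilon>)"
      using assms(2) by (intro powr_mono of_nat_floor) auto
    finally show ?thesis .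
  qed
  ultimately have "8 * real L * 2 powr real L * (1 / \<epsilon>) \<le> 2 powr 3 * 2 powr real L * 2 powr real L * 2 powr (1 / \<epsilon>)"
    using assms(2) by (intro mult_mono) auto
  also have "\<dots> = 2 powr (3 + 2 * real L + 1 / \<epsilon>)"
    unfolding powr_add[symmetric] by (simp add: add.commute)
  also have "\<dots> \<le> 2 powr (14 * q)"
    using L q by (intro powr_mono) linarith+
  finally show "real n \<le> 2 powr (14 * real j / \<epsilon>)"
    using n(2) by (simp add: x_def q_def powr_realpow)
qed

theorem theorem3p1:
  shows "(\<exists>C>0::real. \<forall>\<mu>. borel_prob \<mu> \<and> shift_invariant \<mu> \<longrightarrow>
            (\<forall>j\<ge>1. \<forall>\<epsilon>>0. \<exists>n\<ge>1. real n \<le> 2 powr (C * real j / \<epsilon>) \<and>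
               (\<exists>A\<subseteq>{..<n}. approximates \<mu> j \<epsilon> n A)))
       \<and> (\<forall>j\<ge>1. \<forall>\<epsilon>>0. \<exists>m. \<forall>\<mu>. borel_prob \<mu> \<and> shift_invariant \<mu> \<longrightarrow>
            (\<forall>n\<ge>m. \<exists>A\<subseteq>{..<n}. approximates \<mu> j \<epsilon> n A))"
proof (intro conjI)
  have "\<exists>n\<ge>1. real n \<le> 2 powr (14 * real j / \<epsilon>) \<and> (\<exists>A\<subseteq>{..<n}. approximates \<mu> j \<epsilon> n A)"
    if \<mu>: "borel_prob \<mu>" "shift_invariant \<mu>" and j: "j \<ge> 1" and \<epsilon>: "\<epsilon> > 0" for \<mu> j \<epsilon>
  proof (cases "\<epsilon> \<le> 1")
    case True
    define L where "L = nat \<lceil>4 * real j / \<epsilon>\<rceil>"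
    define n where "n = nat \<lceil>4 * real L * 2 ^ L / \<epsilon>\<rceil>"
    note bounds = length_bound[OF j \<epsilon> True, folded L_def, folded n_def]
    have "\<exists>A\<subseteq>{..<n}. approximates \<mu> j \<epsilon> n A"
    proof (rule approximates_if_long[OF \<mu> j bounds(1) \<epsilon>])
      show "4 * real j / \<epsilon> \<le> real L"
        unfolding L_def by (rule real_nat_ceiling_ge)
      show "4 * real L * 2 ^ L / \<epsilon> \<le> real n"
        unfolding n_def by (rule real_nat_ceiling_ge)
    qed
    then show ?thesis
      using bounds by blast
  next
    case False
    \<comment> \<open>The bound tends to 1 as \<open>\<epsilon>\<close> grows, so
      \<open>n = 1\<close> is the only choice that always fits; any set then approximates.\<close>
    have "real 1 \<le> 2 powr (14 * real j / \<epsilon>)"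
      using \<epsilon> by (simp add: ge_one_powr_ge_zero)
    moreover have "approximates \<mu> j \<epsilon> 1 {}"
      using False by (intro approximates_trivial[OF \<mu>(1)]) simp
    ultimately show ?thesis
      by blast
  qed
  then show "\<exists>C>0::real. \<forall>\<mu>. borel_prob \<mu> \<and> shift_invariant \<mu> \<longrightarrow>
            (\<forall>j\<ge>1. \<forall>\<epsilon>>0. \<exists>n\<ge>1. real n \<le> 2 powr (C * real j / \<epsilon>) \<and>
               (\<exists>A\<subseteq>{..<n}. approximates \<mu> j \<epsilon> n A))"
    by (intro exI[of _ 14]) auto
next
  show "\<forall>j\<ge>1. \<forall>\<epsilon>>0. \<exists>m. \<forall>\<mu>. borel_prob \<mu> \<and> shift_invariant \<mu> \<longrightarrow>
            (\<forall>n\<ge>m. \<exists>A\<subseteq>{..<n}. approximates \<mu> j \<epsilon> n A)"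
  proof (intro allI impI)
    fix j :: nat and \<epsilon> :: real
    assume j: "j \<ge> 1" and \<epsilon>: "\<epsilon> > 0"
    \<comment> \<open>The summand \<open>j\<close> ensures \<open>j \<le> L\<close> for large
      \<open>\<epsilon>\<close> too. The resulting threshold for \<open>n\<close> depends on
      \<open>j\<close> and \<open>\<epsilon>\<close> only, so one \<open>m\<close> serves every
      \<open>\<mu>\<close>.\<close>
    define L where "L = j + nat \<lceil>4 * real j / \<epsilon>\<rceil>"
    have L: "j \<le> L" "4 * real j / \<epsilon> \<le> real L"
      using real_nat_ceiling_ge[of "4 * real j / \<epsilon>"] by (simp_all add: L_def del: of_nat_nat)
    have "\<exists>A\<subseteq>{..<n}. approximates \<mu> j \<epsilon> n A"
      if "borel_prob \<mu>" "shift_invariant \<mu>" "n \<ge> nat \<lceil>4 * real L * 2 ^ L / \<epsilon>\<rceil>" for \<mu> n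
    proof (rule approximates_if_long[OF that(1,2) j L(1) \<epsilon> L(2)])
      show "4 * real L * 2 ^ L / \<epsilon> \<le> real n"
        using that(3) by linarith
    qed
    then show "\<exists>m. \<forall>\<mu>. borel_prob \<mu> \<and> shift_invariant \<mu> \<longrightarrow>
            (\<forall>n\<ge>m. \<exists>A\<subseteq>{..<n}. approximates \<mu> j \<epsilon> n A)"
      by blast
  qed
qed

end
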